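(* Let $n$ be a positive integer, and let $k:=2n+1$. Then the number of good involutions of the linear quandle $\Lambda_{4n,k}$ is \[ |\operatorname{Good}\Lambda_{4n,k}|=\left(\sum_{i=0}^{\lfloor n/2\rfloor}\frac{n!}{(n-2i)!\,i!}\,2^{n-2i}\right)^2. \]
   Context: A quandle is a pair $(X,s)$ where $X$ is a set and $s:X\to S_X$, $x\mapsto s_x$, is a function to the symmetric group $S_X$ such that $s_xs_y=s_{s_x(y)}s_x$ and $s_x(x)=x$ for all $x,y\in X$. For a positive integer $N$ and $k\in(\mathbb{Z}/N\mathbb{Z})^\times$, the linear quandle $\Lambda_{N,k}$ is the quandle with underlying set $\mathbb{Z}/N\mathbb{Z}$ and $s_a(b):=k(b-a)+a$ for all $a,b\in\mathbb{Z}/N\mathbb{Z}$. A good involution of a quandle $(X,s)$ is a permutation $\rho\in S_X$ with $\rho^2=\mathrm{id}_X$ (the identity map is allowed) such that $\rho s_x=s_x\rho$ and $s_{\rho(x)}=s_x^{-1}$ for all $x\in X$. $\operatorname{Good}Q$ denotes the set of all good involutions of $Q$. *)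

theory Defs
  imports Complex_Main "HOL-Combinatorics.Permutations"
begin

text \<open>
  A permutation of \<^term>\<open>X\<close>, i.e. an element of the symmetric group on \<^term>\<open>X\<close>, is a function
  \<^term>\<open>p\<close> with \<^prop>\<open>p permutes X\<close>. Such a function is the identity outside \<^term>\<open>X\<close>, so
  distinct functions are distinct elements of the symmetric group, and \<^term>\<open>inv p\<close> and
  composition are the group operations. The values \<^term>\<open>s x\<close> for \<^term>\<open>x\<close> outside
  \<^term>\<open>X\<close> are irrelevant.
\<close>

type_synonym 'a quandle_data = "'a set \<times> ('a \<Rightarrow> 'a \<Rightarrow> 'a)"

definition quandle :: "'a quandle_data \<Rightarrow> bool" where
  "quandle Q \<longleftrightarrow> (case Q of (X, s) \<Rightarrow>
     (\<forall>x\<in>X. s x permutes X) \<and>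
     (\<forall>x\<in>X. \<forall>y\<in>X. s x \<circ> s y = s (s x y) \<circ> s x) \<and>
     (\<forall>x\<in>X. s x x = x))"

definition good_involution :: "'a quandle_data \<Rightarrow> ('a \<Rightarrow> 'a) \<Rightarrow> bool" where
  "good_involution Q \<rho> \<longleftrightarrow> (case Q of (X, s) \<Rightarrow>
     \<rho> permutes X \<and> \<rho> \<circ> \<rho> = id \<and>
     (\<forall>x\<in>X. \<rho> \<circ> s x = s x \<circ> \<rho>) \<and>
     (\<forall>x\<in>X. s (\<rho> x) = inv (s x)))"

definition Good :: "'a quandle_data \<Rightarrow> ('a \<Rightarrow> 'a) set" where
  "Good Q = {\<rho>. good_involution Q \<rho>}"

text \<open>
  The ring of integers modulo \<^term>\<open>N\<close> is represented by the residues \<^term>\<open>{0..<int N}\<close>.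
  The unit \<^term>\<open>k\<close> is given by any integer representative coprime to \<^term>\<open>N\<close>.
\<close>

definition linear_quandle :: "nat \<Rightarrow> int \<Rightarrow> int quandle_data" where
  "linear_quandle N k =
     ({0..<int N},
      \<lambda>a b. if b \<in> {0..<int N} then (k * (b - a) + a) mod int N else b)"

lemma linear_quandle_mod: "linear_quandle N (k mod int N) = linear_quandle N k"
proof -
  have "(k mod int N * (b - a) + a) mod int N = (k * (b - a) + a) mod int N" for a b
    by (metis mod_add_left_eq mod_mult_left_eq)
  then show ?thesis by (auto simp: linear_quandle_def fun_eq_iff)
qed

lemma quandle_linear_quandle:
  assumes "N > 0" "coprime k (int N)"
  shows "quandle (linear_quandle N k)"
proof -
  let ?X = "{0..<int N}"
  define s where "s = (\<lambda>a b. if b \<in> ?X then (k * (b - a) + a) mod int N else b)"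
  have mem: "s a b \<in> ?X" if "b \<in> ?X" for a b
    using assms(1) that by (simp add: s_def)
  have inj: "inj_on (s a) ?X" for a
  proof (rule inj_onI)
    fix b c assume b: "b \<in> ?X" and c: "c \<in> ?X" and "s a b = s a c"
    then have "int N dvd (k * (b - a) + a) - (k * (c - a) + a)"
      by (simp add: s_def mod_eq_dvd_iff)
    then have "int N dvd k * (b - c)"
      by (simp add: algebra_simps)
    then have "int N dvd b - c"
      using assms(2) by (simp add: coprime_commute coprime_dvd_mult_right_iff)
    then show "b = c"
      using b c by (metis atLeastLessThan_iff mod_eq_dvd_iff mod_pos_pos_trivial)
  qed
  have perm: "s a permutes ?X" for a
  proof (rule bij_imp_permutes)
    show "bij_betw (s a) ?X ?X"
      using inj mem by (metis bij_betw_def endo_inj_surj finite_atLeastLessThan_int image_subsetI)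
    show "s a x = x" if "x \<notin> ?X" for x
      unfolding s_def using that by (rule if_not_P)
  qed
  have distr: "s x (s y z) = s (s x y) (s x z)" if y: "y \<in> ?X" and z: "z \<in> ?X" for x y z
  proof -
    let ?u = "k * (y - x) + x" and ?v = "k * (z - x) + x" and ?w = "k * (z - y) + y"
    have "s x (s y z) = (k * (?w mod int N - x) + x) mod int N"
      using mem[OF z, of y] z by (simp add: s_def)
    also have "\<dots> = (k * (?w - x) + x) mod int N"
      by (intro mod_add_cong mod_mult_cong mod_diff_cong) simp_all
    also have "k * (?w - x) + x = k * (?v - ?u) + ?u"
      by (simp add: algebra_simps)
    also have "(k * (?v - ?u) + ?u) mod int N
        = (k * (?v mod int N - ?u mod int N) + ?u mod int N) mod int N"
      by (intro mod_add_cong mod_mult_cong mod_diff_cong) simp_all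
    also have "\<dots> = s (s x y) (s x z)"
      using mem[OF z, of x] y z by (simp add: s_def)
    finally show ?thesis .
  qed
  have "s x \<circ> s y = s (s x y) \<circ> s x" if "y \<in> ?X" for x y
  proof
    fix z show "(s x \<circ> s y) z = (s (s x y) \<circ> s x) z"
      using distr[OF that, of z x] by (cases "z \<in> ?X") (auto simp: s_def)
  qed
  moreover have "s x x = x" if "x \<in> ?X" for x
    using that by (simp add: s_def)
  ultimately show ?thesis
    using perm unfolding quandle_def linear_quandle_def s_def[symmetric] by simp
qed

end

theory Submission
  imports Defs
begin

text \<open>
  Modulo \<open>4n\<close>, multiplication by \<open>k = 2n + 1\<close> fixes even residues and adds \<open>2n\<close> to odd ones. Hence
  \<open>s\<^sub>a\<close> fixes every \<open>b\<close> with the parity of \<open>a\<close> and moves every other \<open>b\<close> to \<open>\<tau> b = b + 2n\<close>. In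
  particular \<open>s\<^sub>a\<close> is an involution that depends on the parity of \<open>a\<close> only, and the two parities give
  different maps. So the condition \<open>s\<^bsub>\<rho> a\<^esub> = s\<^sub>a\<^sup>-\<^sup>1\<close> says that \<open>\<rho>\<close> preserves parity, and once it does,
  commuting with all \<open>s\<^sub>a\<close> means commuting with \<open>\<tau>\<close> (\<open>good_involution_half_turn_iff\<close>).

  Now \<open>\<tau>\<close> is an involution without fixed points that preserves parity, so a good involution amounts
  to two independent choices (\<open>card_commuting_involutions_preserving\<close>): an involution commuting
  with \<open>\<tau>\<close> on the \<open>2n\<close> even residues, and another on the \<open>2n\<close> odd ones. This gives the square.

  The involutions commuting with \<open>\<tau>\<close> on a set made of \<open>n\<close> orbits of \<open>\<tau>\<close> are the involutions of the
  hyperoctahedral group, that is, the signed permutations of \<open>n\<close> letters that square to the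
  identity. In closed form: \<open>i\<close> pairs of orbits are interchanged, each in one of two ways, and each
  of the other \<open>n - 2i\<close> orbits is either fixed pointwise or flipped, which makes
  \<open>n! / ((n - 2i)! i! 2\<^sup>i) * 2\<^sup>i * 2\<^bsup>n - 2i\<^esup>\<close> possibilities. The proof reaches this sum through
  the recurrence \<open>S (n + 1) = 2 S n + 2n S (n - 1)\<close>. For the count it comes from the image of one
  chosen point \<open>a\<close>: the orbit of \<open>a\<close> is mapped to itself in two ways, or \<open>a\<close> goes to one of the \<open>2n\<close>
  points outside its orbit, and then two whole orbits are used up
  (\<open>card_commuting_involutions_rec\<close>). For the sum it holds summand by summand
  (\<open>signed_involution_term_Suc\<close>).
\<close>

section \<open>Involutions commuting with a free involution\<close>

definition free_involution_on :: "'a set \<Rightarrow> ('a \<Rightarrow> 'a) \<Rightarrow> bool" where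
  "free_involution_on A \<tau> \<longleftrightarrow> (\<forall>x\<in>A. \<tau> x \<in> A \<and> \<tau> (\<tau> x) = x \<and> \<tau> x \<noteq> x)"

text \<open>
  The elements are functions on the whole type that are the identity off \<^term>\<open>A\<close>, so that
  restricting to a subset and composing elements for disjoint sets stay inside the same type.
  That they map \<^term>\<open>A\<close> to itself follows from the first two conditions.
\<close>

definition commuting_involutions :: "('a \<Rightarrow> 'a) \<Rightarrow> 'a set \<Rightarrow> ('a \<Rightarrow> 'a) set" where
  "commuting_involutions \<tau> A =
     {\<rho>. (\<forall>x. \<rho> (\<rho> x) = x) \<and> (\<forall>x. x \<notin> A \<longrightarrow> \<rho> x = x) \<and> (\<forall>x\<in>A. \<rho> (\<tau> x) = \<tau> (\<rho> x))}"

lemma commuting_involutions_invol: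
  "\<rho> \<in> commuting_involutions \<tau> A \<Longrightarrow> \<rho> (\<rho> x) = x"
  by (simp add: commuting_involutions_def)

lemma commuting_involutions_outside:
  "\<rho> \<in> commuting_involutions \<tau> A \<Longrightarrow> x \<notin> A \<Longrightarrow> \<rho> x = x"
  by (simp add: commuting_involutions_def)

lemma commuting_involutions_commute:
  "\<rho> \<in> commuting_involutions \<tau> A \<Longrightarrow> x \<in> A \<Longrightarrow> \<rho> (\<tau> x) = \<tau> (\<rho> x)"
  by (simp add: commuting_involutions_def)

lemma commuting_involutions_in:
  "\<rho> \<in> commuting_involutions \<tau> A \<Longrightarrow> x \<in> A \<Longrightarrow> \<rho> x \<in> A"
  by (metis commuting_involutions_invol commuting_involutions_outside)

lemma commuting_involutions_permutes:
  "\<rho> \<in> commuting_involutions \<tau> A \<Longrightarrow> \<rho> permutes A"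
  unfolding permutes_def by (metis commuting_involutions_invol commuting_involutions_outside)

lemma finite_commuting_involutions: "finite A \<Longrightarrow> finite (commuting_involutions \<tau> A)"
  by (rule finite_subset[OF _ finite_permutations[of A]])
     (auto intro: commuting_involutions_permutes)

text \<open>
  Composing with \<^term>\<open>\<sigma>\<close> cancels the prescribed behaviour on \<^term>\<open>B\<close> and changes nothing outside,
  because an involution that maps \<^term>\<open>B\<close> to itself also maps its complement to itself. The same
  composition undoes this, since \<^term>\<open>\<sigma>\<close> is an involution.
\<close>

lemma bij_betw_extensions:
  assumes B: "B \<subseteq> A" and \<tau>A: "free_involution_on A \<tau>" and \<tau>B: "free_involution_on B \<tau>"
    and \<sigma>: "\<sigma> \<in> commuting_involutions \<tau> B"
  shows "bij_betw (\<lambda>\<rho>. \<sigma> \<circ> \<rho>)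
           {\<rho> \<in> commuting_involutions \<tau> A. \<forall>x\<in>B. \<rho> x = \<sigma> x} (commuting_involutions \<tau> (A - B))"
proof -
  note \<sigma>_simps = commuting_involutions_invol[OF \<sigma>] commuting_involutions_outside[OF \<sigma>]
    commuting_involutions_in[OF \<sigma>] commuting_involutions_commute[OF \<sigma>]
  have \<tau>_diff: "\<tau> x \<in> A - B" if "x \<in> A - B" for x
    using that \<tau>A \<tau>B unfolding free_involution_on_def by (metis Diff_iff)
  show ?thesis
  proof (rule bij_betw_byWitness[where f' = "\<lambda>\<pi>. \<sigma> \<circ> \<pi>"])
    show "\<forall>\<rho>\<in>{\<rho> \<in> commuting_involutions \<tau> A. \<forall>x\<in>B. \<rho> x = \<sigma> x}. \<sigma> \<circ> (\<sigma> \<circ> \<rho>) = \<rho>"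
      "\<forall>\<pi>\<in>commuting_involutions \<tau> (A - B). \<sigma> \<circ> (\<sigma> \<circ> \<pi>) = \<pi>"
      by (auto simp: fun_eq_iff \<sigma>_simps)
    show "(\<circ>) \<sigma> ` {\<rho> \<in> commuting_involutions \<tau> A. \<forall>x\<in>B. \<rho> x = \<sigma> x}
        \<subseteq> commuting_involutions \<tau> (A - B)"
    proof safe
      fix \<rho> assume \<rho>: "\<rho> \<in> commuting_involutions \<tau> A" and eq: "\<forall>x\<in>B. \<rho> x = \<sigma> x"
      note \<rho>_simps = commuting_involutions_invol[OF \<rho>] commuting_involutions_outside[OF \<rho>]
        commuting_involutions_in[OF \<rho>] commuting_involutions_commute[OF \<rho>]
      have notin: "\<rho> x \<notin> B" if "x \<notin> B" for x
        using that eq \<sigma>_simps(3) \<rho>_simps(1) by metis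
      have val: "(\<sigma> \<circ> \<rho>) x = (if x \<in> B then x else \<rho> x)" for x
        using notin eq by (simp add: \<sigma>_simps)
      show "\<sigma> \<circ> \<rho> \<in> commuting_involutions \<tau> (A - B)"
        unfolding commuting_involutions_def mem_Collect_eq val
        using notin \<rho>_simps \<tau>_diff by auto
    qed
    show "(\<circ>) \<sigma> ` commuting_involutions \<tau> (A - B)
        \<subseteq> {\<rho> \<in> commuting_involutions \<tau> A. \<forall>x\<in>B. \<rho> x = \<sigma> x}"
    proof safe
      fix \<pi> assume \<pi>: "\<pi> \<in> commuting_involutions \<tau> (A - B)"
      note \<pi>_simps = commuting_involutions_invol[OF \<pi>] commuting_involutions_outside[OF \<pi>]
        commuting_involutions_in[OF \<pi>] commuting_involutions_commute[OF \<pi>]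
      have notin: "\<pi> x \<notin> B" if "x \<notin> B" for x
        using that \<pi>_simps by (metis Diff_iff)
      have val: "(\<sigma> \<circ> \<pi>) x = (if x \<in> B then \<sigma> x else \<pi> x)" for x
        using notin by (simp add: \<sigma>_simps \<pi>_simps)
      show "\<sigma> \<circ> \<pi> \<in> commuting_involutions \<tau> A"
        unfolding commuting_involutions_def mem_Collect_eq val
        using notin \<pi>_simps \<tau>_diff \<sigma>_simps B \<tau>B unfolding free_involution_on_def
        by auto
      show "(\<sigma> \<circ> \<pi>) x = \<sigma> x" if "x \<in> B" for x
        using val that by simp
    qed
  qed
qed

lemma card_extensions:
  assumes "B \<subseteq> A" "free_involution_on A \<tau>" "free_involution_on B \<tau>"
    and "\<sigma> \<in> commuting_involutions \<tau> B"
  shows "card {\<rho> \<in> commuting_involutions \<tau> A. \<forall>x\<in>B. \<rho> x = \<sigma> x}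
       = card (commuting_involutions \<tau> (A - B))"
  using bij_betw_same_card[OF bij_betw_extensions[OF assms]] .

text \<open>
  Classify by the restriction to \<^term>\<open>E\<close>: it can be any commuting involution of \<^term>\<open>E\<close>, and the
  number of ways to extend it to \<^term>\<open>X\<close> does not depend on it.
\<close>

lemma card_commuting_involutions_preserving:
  assumes fin: "finite X" and \<tau>: "free_involution_on X \<tau>"
    and E: "E \<subseteq> X" "free_involution_on E \<tau>"
  shows "card {\<rho> \<in> commuting_involutions \<tau> X. \<forall>x\<in>X. \<rho> x \<in> E \<longleftrightarrow> x \<in> E} =
    card (commuting_involutions \<tau> E) * card (commuting_involutions \<tau> (X - E))"
proof -
  let ?I = "commuting_involutions \<tau>"
  define F where "F \<sigma> = {\<rho> \<in> ?I X. \<forall>x\<in>E. \<rho> x = \<sigma> x}" for \<sigma>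
  have "{\<rho> \<in> ?I X. \<forall>x\<in>X. \<rho> x \<in> E \<longleftrightarrow> x \<in> E} = (\<Union>\<sigma>\<in>?I E. F \<sigma>)"
  proof (intro equalityI subsetI)
    fix \<rho> assume "\<rho> \<in> {\<rho> \<in> ?I X. \<forall>x\<in>X. \<rho> x \<in> E \<longleftrightarrow> x \<in> E}"
    then have \<rho>: "\<rho> \<in> ?I X" and pres: "\<And>x. x \<in> X \<Longrightarrow> \<rho> x \<in> E \<longleftrightarrow> x \<in> E"
      by auto
    define \<sigma> where "\<sigma> x = (if x \<in> E then \<rho> x else x)" for x
    have "\<sigma> \<in> ?I E"
      using pres E commuting_involutions_invol[OF \<rho>] commuting_involutions_commute[OF \<rho>]
      by (auto simp: commuting_involutions_def \<sigma>_def free_involution_on_def subset_iff)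
    moreover have "\<rho> \<in> F \<sigma>"
      using \<rho> by (simp add: F_def \<sigma>_def)
    ultimately show "\<rho> \<in> (\<Union>\<sigma>\<in>?I E. F \<sigma>)" by blast
  next
    fix \<rho> assume "\<rho> \<in> (\<Union>\<sigma>\<in>?I E. F \<sigma>)"
    then obtain \<sigma> where \<sigma>: "\<sigma> \<in> ?I E" and \<rho>: "\<rho> \<in> ?I X" and eq: "\<And>x. x \<in> E \<Longrightarrow> \<rho> x = \<sigma> x"
      by (auto simp: F_def)
    have "\<rho> x \<in> E \<longleftrightarrow> x \<in> E" for x
      using eq commuting_involutions_in[OF \<sigma>] commuting_involutions_invol[OF \<rho>] by metis
    with \<rho> show "\<rho> \<in> {\<rho> \<in> ?I X. \<forall>x\<in>X. \<rho> x \<in> E \<longleftrightarrow> x \<in> E}" by blast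
  qed
  moreover have "card (\<Union>\<sigma>\<in>?I E. F \<sigma>) = (\<Sum>\<sigma>\<in>?I E. card (F \<sigma>))"
  proof (rule card_UN_disjoint)
    show "finite (?I E)"
      using finite_subset[OF E(1) fin] by (rule finite_commuting_involutions)
    show "\<forall>\<sigma>\<in>?I E. finite (F \<sigma>)"
      using finite_commuting_involutions[OF fin] by (simp add: F_def)
    show "\<forall>\<sigma>\<in>?I E. \<forall>\<sigma>'\<in>?I E. \<sigma> \<noteq> \<sigma>' \<longrightarrow> F \<sigma> \<inter> F \<sigma>' = {}"
    proof (intro ballI impI, rule ccontr)
      fix \<sigma> \<sigma>' assume \<sigma>: "\<sigma> \<in> ?I E" "\<sigma>' \<in> ?I E" "\<sigma> \<noteq> \<sigma>'" and "F \<sigma> \<inter> F \<sigma>' \<noteq> {}"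
      then have "\<sigma> x = \<sigma>' x" if "x \<in> E" for x
        using that by (auto simp: F_def)
      then have "\<sigma> x = \<sigma>' x" for x
        using commuting_involutions_outside[OF \<sigma>(1)] commuting_involutions_outside[OF \<sigma>(2)] by metis
      with \<sigma>(3) show False by auto
    qed
  qed
  moreover have "card (F \<sigma>) = card (?I (X - E))" if "\<sigma> \<in> ?I E" for \<sigma>
    unfolding F_def using card_extensions[OF E(1) \<tau> E(2) that] .
  ultimately show ?thesis by simp
qed

lemma free_involution_on_Diff_orbit:
  assumes "free_involution_on A \<tau>" "a \<in> A"
  shows "free_involution_on (A - {a, \<tau> a}) \<tau>"
  using assms unfolding free_involution_on_def by (metis DiffE DiffI insertCI insertE singletonD)

text \<open>
  Classify by the image of \<^term>\<open>a\<close>. This image determines an element on the whole orbit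
  \<^term>\<open>{a, \<tau> a}\<close>, and by involutivity on the orbit of the image too. In each case the prescribed
  part is a commuting involution on a union of orbits, so \<open>card_extensions\<close> counts the rest.
\<close>

lemma card_commuting_involutions_rec:
  assumes fin: "finite A" and \<tau>: "free_involution_on A \<tau>" and a: "a \<in> A"
  shows "card (commuting_involutions \<tau> A) = 2 * card (commuting_involutions \<tau> (A - {a, \<tau> a}))
      + (\<Sum>c\<in>A - {a, \<tau> a}. card (commuting_involutions \<tau> (A - {a, \<tau> a} - {c, \<tau> c})))"
proof -
  let ?I = "commuting_involutions \<tau>" and ?b = "\<tau> a"
  define F where "F y = {\<rho> \<in> ?I A. \<rho> a = y}" for y
  have b: "?b \<in> A" "\<tau> ?b = a" "?b \<noteq> a"
    using \<tau> a by (auto simp: free_involution_on_def)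
  have \<tau>ab: "free_involution_on {a, ?b} \<tau>"
    using b by (auto simp: free_involution_on_def)
  have \<rho>b: "\<rho> ?b = \<tau> (\<rho> a)" if "\<rho> \<in> ?I A" for \<rho>
    using commuting_involutions_commute[OF that a] .
  have Fa: "card (F a) = card (?I (A - {a, ?b}))"
  proof -
    have "F a = {\<rho> \<in> ?I A. \<forall>x\<in>{a, ?b}. \<rho> x = id x}"
      by (auto simp: F_def dest: \<rho>b)
    moreover have "id \<in> ?I {a, ?b}"
      by (simp add: commuting_involutions_def)
    ultimately show ?thesis
      using card_extensions[OF _ \<tau> \<tau>ab, of id] a b by simp
  qed
  have Fb: "card (F ?b) = card (?I (A - {a, ?b}))"
  proof -
    have "F ?b = {\<rho> \<in> ?I A. \<forall>x\<in>{a, ?b}. \<rho> x = transpose a ?b x}"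
      using b by (auto simp: F_def dest: \<rho>b)
    moreover have "transpose a ?b \<in> ?I {a, ?b}"
      using b by (auto simp: commuting_involutions_def transpose_def)
    ultimately show ?thesis
      using card_extensions[OF _ \<tau> \<tau>ab, of "transpose a ?b"] a b by simp
  qed
  have Fc: "card (F c) = card (?I (A - {a, ?b} - {c, \<tau> c}))" if c: "c \<in> A - {a, ?b}" for c
  proof -
    let ?d = "\<tau> c" and ?\<sigma> = "transpose a c \<circ> transpose ?b (\<tau> c)"
    have d: "?d \<in> A" "\<tau> ?d = c" "?d \<noteq> c" "?d \<noteq> a" "?d \<noteq> ?b"
      using \<tau> c b free_involution_on_Diff_orbit[OF \<tau> a] by (auto simp: free_involution_on_def)
    have "F c = {\<rho> \<in> ?I A. \<forall>x\<in>{a, ?b, c, ?d}. \<rho> x = ?\<sigma> x}"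
    proof (intro equalityI subsetI)
      fix \<rho> assume "\<rho> \<in> F c"
      then have \<rho>: "\<rho> \<in> ?I A" "\<rho> a = c"
        by (auto simp: F_def)
      then have "\<rho> c = a" "\<rho> ?b = ?d" "\<rho> ?d = ?b"
        using \<rho>b commuting_involutions_invol by metis+
      with \<rho> show "\<rho> \<in> {\<rho> \<in> ?I A. \<forall>x\<in>{a, ?b, c, ?d}. \<rho> x = ?\<sigma> x}"
        using b c d by (auto simp: transpose_def)
    next
      fix \<rho> assume "\<rho> \<in> {\<rho> \<in> ?I A. \<forall>x\<in>{a, ?b, c, ?d}. \<rho> x = ?\<sigma> x}"
      then show "\<rho> \<in> F c"
        using b c d by (auto simp: F_def transpose_def)
    qed
    moreover have "?\<sigma> \<in> ?I {a, ?b, c, ?d}"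
      using b c d by (auto simp: commuting_involutions_def transpose_def)
    moreover have "free_involution_on {a, ?b, c, ?d} \<tau>"
      using b d by (auto simp: free_involution_on_def)
    moreover have "A - {a, ?b, c, ?d} = A - {a, ?b} - {c, ?d}"
      by blast
    ultimately show ?thesis
      using card_extensions[OF _ \<tau>, of "{a, ?b, c, ?d}" ?\<sigma>] a b c d by simp
  qed
  have "?I A = (\<Union>y\<in>A. F y)"
    using commuting_involutions_in[OF _ a] by (auto simp: F_def)
  then have "card (?I A) = (\<Sum>y\<in>A. card (F y))"
    using card_UN_disjoint[of A F] fin finite_commuting_involutions[OF fin, of \<tau>]
    by (auto simp: F_def)
  also have "\<dots> = (\<Sum>y\<in>A - {a, ?b}. card (F y)) + (\<Sum>y\<in>{a, ?b}. card (F y))"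
    using fin a b by (intro sum.subset_diff) auto
  also have "(\<Sum>y\<in>{a, ?b}. card (F y)) = 2 * card (?I (A - {a, ?b}))"
    using b(3)[symmetric] by (simp add: Fa Fb)
  finally show ?thesis
    using Fc by simp
qed

section \<open>Summing the closed form\<close>

text \<open>
  Extending the summands by zero beyond \<^term>\<open>n div 2\<close> lets sums for different \<^term>\<open>n\<close> share
  one index range, so that the recurrence can be compared term by term.
\<close>

definition signed_involution_term :: "nat \<Rightarrow> nat \<Rightarrow> real" where
  "signed_involution_term n i =
     (if 2 * i \<le> n then fact n / (fact (n - 2 * i) * fact i) * 2 ^ (n - 2 * i) else 0)"

definition signed_involution_sum :: "nat \<Rightarrow> real" where
  "signed_involution_sum n =
     (\<Sum>i = 0..n div 2. fact n / (fact (n - 2 * i) * fact i) * 2 ^ (n - 2 * i))"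

lemma signed_involution_sum_eq:
  assumes "n div 2 \<le> m"
  shows "signed_involution_sum n = (\<Sum>i\<le>m. signed_involution_term n i)"
  unfolding signed_involution_sum_def
  by (rule sum.mono_neutral_cong_left) (use assms in \<open>auto simp: signed_involution_term_def\<close>)

lemma signed_involution_term_0:
  "signed_involution_term (Suc n) 0 = 2 * signed_involution_term n 0"
  by (simp add: signed_involution_term_def)

text \<open>
  If \<open>2 (i + 1) \<le> n + 1\<close>, put \<open>m = n + 1 - 2 (i + 1)\<close>. All three terms are multiples of \<open>n! 2\<^sup>m / (m! (i + 1)!)\<close>, with
  coefficients \<open>n + 1\<close> on the left and \<open>m\<close> and \<open>2 (i + 1)\<close> on the right. For \<open>n = 0\<close> the truncated
  \<open>n - 1\<close> is harmless because of the factor \<open>n\<close>.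
\<close>

lemma signed_involution_term_Suc:
  "signed_involution_term (Suc n) (Suc i) =
     2 * signed_involution_term n (Suc i) + 2 * real n * signed_involution_term (n - 1) i"
proof -
  \<comment> \<open>In the middle case \<open>m = 0\<close>, and the first term on the right is one of the terms set to zero.\<close>
  consider "n < 2 * i + 1" | "n = 2 * i + 1" | m where "n = 2 * i + 2 + m"
    by (metis Suc_eq_plus1 add_2_eq_Suc' le_iff_add not_less not_less_eq_eq le_antisym)
  then show ?thesis
  proof cases
    case 1
    then show ?thesis by (cases n) (auto simp: signed_involution_term_def)
  next
    case 2
    then show ?thesis
      by (simp add: signed_involution_term_def divide_simps) (simp add: algebra_simps)
  next
    case 3
    have "fact n = real n * fact (n - 1)" and "real n = 2 * i + 2 + m"
      using 3 by (simp_all add: fact_reduce)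
    then show ?thesis
      using 3 by (simp add: signed_involution_term_def divide_simps) (simp add: algebra_simps)
  qed
qed

lemma signed_involution_sum_Suc:
  "signed_involution_sum (Suc n) =
     2 * signed_involution_sum n + 2 * real n * signed_involution_sum (n - 1)"
proof -
  have "signed_involution_sum (Suc n) = (\<Sum>i\<le>Suc n. signed_involution_term (Suc n) i)"
    by (rule signed_involution_sum_eq) simp
  also have "\<dots> = 2 * (\<Sum>i\<le>Suc n. signed_involution_term n i)
      + 2 * real n * (\<Sum>i\<le>n. signed_involution_term (n - 1) i)"
    unfolding sum.atMost_Suc_shift
    by (simp add: signed_involution_term_0 signed_involution_term_Suc sum.distrib sum_distrib_left
        algebra_simps)
  also have "\<dots> = 2 * signed_involution_sum n + 2 * real n * signed_involution_sum (n - 1)"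
    by (subst (1 2) signed_involution_sum_eq[symmetric]) auto
  finally show ?thesis .
qed

section \<open>The number of commuting involutions\<close>

lemma card_commuting_involutions:
  assumes "finite A" "free_involution_on A \<tau>" "card A = 2 * n"
  shows "real (card (commuting_involutions \<tau> A)) = signed_involution_sum n"
  using assms
proof (induction n arbitrary: A rule: less_induct)
  case (less n)
  show ?case
  proof (cases n)
    case 0
    then have "commuting_involutions \<tau> A = {id}"
      using less.prems by (auto simp: commuting_involutions_def)
    then show ?thesis
      using 0 by (simp add: signed_involution_sum_def)
  next
    case (Suc m)
    have diff: "card (B - {c, \<tau> c}) = card B - 2" if "c \<in> B" "free_involution_on B \<tau>" for B c
      using that by (subst card_Diff_subset) (auto simp: free_involution_on_def card_insert_if)
    obtain a where a: "a \<in> A"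
      using less.prems Suc by fastforce
    let ?A = "A - {a, \<tau> a}"
    have \<tau>': "free_involution_on ?A \<tau>"
      using free_involution_on_Diff_orbit[OF less.prems(2) a] .
    have card': "card ?A = 2 * m"
      using diff[OF a less.prems(2)] less.prems(3) Suc by simp
    have 1: "real (card (commuting_involutions \<tau> ?A)) = signed_involution_sum m"
      using less.IH[of m ?A] less.prems(1) \<tau>' card' Suc by simp
    have 2: "real (card (commuting_involutions \<tau> (?A - {c, \<tau> c}))) = signed_involution_sum (m - 1)"
      if c: "c \<in> ?A" for c
      using less.IH[of "m - 1" "?A - {c, \<tau> c}"] less.prems(1) card' Suc
        free_involution_on_Diff_orbit[OF \<tau>' c] diff[OF c \<tau>']
      by (simp add: right_diff_distrib')
    show ?thesis
      unfolding card_commuting_involutions_rec[OF less.prems(1,2) a]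
      using 1 2 card' Suc by (simp add: signed_involution_sum_Suc)
  qed
qed

section \<open>Good involutions of the linear quandle\<close>

definition half_turn :: "nat \<Rightarrow> int \<Rightarrow> int" where
  "half_turn n x = (x + 2 * int n) mod int (4 * n)"

lemma half_turn:
  assumes "n > 0" "x \<in> {0..<int (4 * n)}"
  shows "half_turn n x \<in> {0..<int (4 * n)}" "half_turn n (half_turn n x) = x"
    "half_turn n x \<noteq> x" "even (half_turn n x) = even x"
proof -
  have "half_turn n x = (if x < 2 * int n then x + 2 * int n else x - 2 * int n)"
    if "x \<in> {0..<int (4 * n)}" for x
  proof (cases "x < 2 * int n")
    case False
    have "(x + 2 * int n) mod int (4 * n) = (x - 2 * int n + int (4 * n)) mod int (4 * n)"
      by (simp add: algebra_simps)
    also have "\<dots> = x - 2 * int n"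
      unfolding mod_add_self2 using that False by simp
    finally show ?thesis using False by (simp add: half_turn_def)
  qed (use that in \<open>simp add: half_turn_def\<close>)
  then show "half_turn n x \<in> {0..<int (4 * n)}" "half_turn n (half_turn n x) = x"
    "half_turn n x \<noteq> x" "even (half_turn n x) = even x"
    using assms by auto
qed

text \<open>
  Here \<open>s\<^sub>a b = b + 2n (b - a)\<close>, and modulo \<open>4n\<close> the product \<open>2n (b - a)\<close> depends only on the
  parity of \<open>b - a\<close>.
\<close>

lemma linear_quandle_half_turn:
  assumes "k = 2 * int n + 1" "b \<in> {0..<int (4 * n)}"
  shows "snd (linear_quandle (4 * n) k) a b =
    (if even (b - a) then b else half_turn n b)"
proof -
  have eq: "k * (b - a) + a = b + 2 * int n * (b - a)"
    using assms(1) by (simp add: algebra_simps)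
  show ?thesis
  proof (cases "even (b - a)")
    case True
    then obtain c where "b - a = 2 * c" ..
    then have "k * (b - a) + a = b + int (4 * n) * c"
      using eq by simp
    then show ?thesis
      using assms(2) True by (simp add: linear_quandle_def)
  next
    case False
    then obtain c where "b - a = 2 * c + 1" ..
    then have "k * (b - a) + a = b + 2 * int n + int (4 * n) * c"
      using eq by (simp add: algebra_simps)
    then have "(k * (b - a) + a) mod int (4 * n) = half_turn n b"
      unfolding half_turn_def by (metis mod_mult_self2)
    then show ?thesis
      using assms(2) False by (simp add: linear_quandle_def)
  qed
qed

text \<open>
  As \<open>s\<^sub>a\<close> is its own inverse and depends exactly on the parity of \<open>a\<close>, the condition on inverses
  becomes preservation of parity. Each \<open>s\<^sub>a\<close> is the identity on one parity class and \<open>\<tau>\<close> on the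
  other, which turns the commutation conditions into commutation with \<open>\<tau>\<close>.
\<close>

lemma good_involution_half_turn_iff:
  fixes n :: nat and k :: int
  defines "X \<equiv> {0..<int (4 * n)}" and "\<tau> \<equiv> half_turn n"
  assumes n: "n > 0" and k: "k = 2 * int n + 1"
  shows "good_involution (linear_quandle (4 * n) k) \<rho> \<longleftrightarrow>
    \<rho> \<in> commuting_involutions \<tau> X \<and> (\<forall>x\<in>X. even (\<rho> x) = even x)"
proof -
  define s where "s = snd (linear_quandle (4 * n) k)"
  have Q: "linear_quandle (4 * n) k = (X, s)"
    by (simp add: linear_quandle_def s_def X_def)
  have s: "s a b = (if even (b - a) then b else \<tau> b)" if "b \<in> X" for a b
    using linear_quandle_half_turn[OF k, of b a] that by (simp add: s_def X_def \<tau>_def)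
  have s_out: "s a b = b" if "b \<notin> X" for a b
    using that unfolding s_def linear_quandle_def X_def snd_conv by (rule if_not_P)
  have \<tau>: "\<tau> x \<in> X" "\<tau> (\<tau> x) = x" "\<tau> x \<noteq> x" "even (\<tau> x) = even x" if "x \<in> X" for x
    using half_turn[OF n] that by (simp_all add: X_def \<tau>_def)
  have ss: "s a (s a b) = b" for a b
    using s s_out \<tau> by (cases "b \<in> X") auto
  have inv_s: "inv (s a) = s a" for a
    using ss by (intro inv_unique_comp) (auto simp: fun_eq_iff)
  have s_eq_iff: "s a = s b \<longleftrightarrow> even a = even b" for a b
  proof
    assume "s a = s b"
    then have "s a 0 = s b 0" by simp
    moreover have "0 \<in> X" using n by (simp add: X_def)
    ultimately show "even a = even b"
      using s[of 0] \<tau>[of 0] by (auto split: if_splits)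
  next
    assume "even a = even b"
    then have "s a x = s b x" for x
      using s s_out by (cases "x \<in> X") simp_all
    then show "s a = s b" ..
  qed
  have 01: "0 \<in> X" "1 \<in> X" using n by (auto simp: X_def)
  show ?thesis
  proof
    assume "good_involution (linear_quandle (4 * n) k) \<rho>"
    then have perm: "\<rho> permutes X" and invol: "\<rho> \<circ> \<rho> = id"
      and comm: "\<And>x. x \<in> X \<Longrightarrow> \<rho> \<circ> s x = s x \<circ> \<rho>"
      and par: "\<forall>x\<in>X. even (\<rho> x) = even x"
      unfolding Q good_involution_def by (auto simp: inv_s s_eq_iff)
    have "\<rho> (\<tau> x) = \<tau> (\<rho> x)" if x: "x \<in> X" for x
    proof -
      \<comment> \<open>A point of the opposite parity, so that \<open>s\<^sub>a\<close> acts as \<open>\<tau>\<close> on both \<open>x\<close> and \<open>\<rho> x\<close>.\<close>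
      define a :: int where "a = (if even x then 1 else 0)"
      have a: "a \<in> X" "odd (x - a)" "odd (\<rho> x - a)"
        using 01 par x by (auto simp: a_def)
      have "\<rho> (s a x) = s a (\<rho> x)"
        using comm[OF a(1)] by (metis comp_apply)
      then show ?thesis
        using s x a permutes_in_image[OF perm, of x] by simp
    qed
    then show "\<rho> \<in> commuting_involutions \<tau> X \<and> (\<forall>x\<in>X. even (\<rho> x) = even x)"
      using par perm invol
      by (auto simp: commuting_involutions_def permutes_not_in fun_eq_iff)
  next
    assume *: "\<rho> \<in> commuting_involutions \<tau> X \<and> (\<forall>x\<in>X. even (\<rho> x) = even x)"
    then have \<rho>: "\<rho> \<in> commuting_involutions \<tau> X" and par: "\<And>x. x \<in> X \<Longrightarrow> even (\<rho> x) = even x"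
      by auto
    have "\<rho> (s a x) = s a (\<rho> x)" for a x
    proof (cases "x \<in> X")
      case True
      then show ?thesis
        using s par commuting_involutions_in[OF \<rho>] commuting_involutions_commute[OF \<rho>]
        by simp
    qed (simp add: s_out commuting_involutions_outside[OF \<rho>])
    then have "\<rho> \<circ> s a = s a \<circ> \<rho>" for a
      by (simp add: fun_eq_iff)
    moreover have "\<rho> \<circ> \<rho> = id"
      using commuting_involutions_invol[OF \<rho>] by (simp add: fun_eq_iff)
    ultimately show "good_involution (linear_quandle (4 * n) k) \<rho>"
      unfolding Q good_involution_def
      using commuting_involutions_permutes[OF \<rho>] par by (simp add: inv_s s_eq_iff)
  qed
qed

theorem theorem5p11:
  fixes n :: nat and k :: int
  assumes "n > 0" and "k = 2 * int n + 1"
  shows "real (card (Good (linear_quandle (4 * n) k))) =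
    (\<Sum>i = 0..n div 2. fact n / (fact (n - 2 * i) * fact i) * 2 ^ (n - 2 * i))\<^sup>2"
proof -
  define X where "X = {0..<int (4 * n)}"
  define E where "E = {x \<in> X. even x}"
  define \<tau> where "\<tau> = half_turn n"
  let ?I = "commuting_involutions \<tau>"
  have \<tau>: "free_involution_on X \<tau>" "free_involution_on E \<tau>" "free_involution_on (X - E) \<tau>"
    using half_turn[OF assms(1)] by (auto simp: free_involution_on_def E_def X_def \<tau>_def)
  have evens: "E = (\<lambda>j. 2 * j) ` {0..<2 * int n}"
    by (auto simp: E_def X_def elim!: evenE)
  have card_E: "card E = 2 * n"
    unfolding evens by (subst card_image) (auto simp: inj_on_def)
  have "E \<subseteq> X" "finite X" by (auto simp: E_def X_def)
  then have EX: "E \<subseteq> X" "finite X" "finite E" by (auto intro: finite_subset)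
  have card_O: "card (X - E) = 2 * n"
    using card_Diff_subset[of E X] EX card_E by (simp add: X_def)
  have "Good (linear_quandle (4 * n) k) = {\<rho> \<in> ?I X. \<forall>x\<in>X. \<rho> x \<in> E \<longleftrightarrow> x \<in> E}"
    using good_involution_half_turn_iff[OF assms] commuting_involutions_in[of _ \<tau> X]
    by (fastforce simp: Good_def E_def X_def \<tau>_def)
  then have "card (Good (linear_quandle (4 * n) k)) = card (?I E) * card (?I (X - E))"
    using card_commuting_involutions_preserving[of X \<tau> E] EX \<tau> by simp
  then have "real (card (Good (linear_quandle (4 * n) k))) = (signed_involution_sum n)\<^sup>2"
    using card_commuting_involutions[of E \<tau> n] card_commuting_involutions[of "X - E" \<tau> n]
      EX \<tau> card_E card_O by (simp add: power2_eq_square)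
  then show ?thesis
    by (simp add: signed_involution_sum_def)
qed

end
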